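(* Let $0<t\le 1$ be a real number, let $n\ge\lfloor 1/t\rfloor+2$ be an integer, and let $\pi=(d_1\le d_2\le\dots\le d_n)$ be a graphical sequence. Suppose that (i) for every integer $i$ with $\lfloor 1/t\rfloor\le i<\frac12\bigl(n+\lfloor 1/t\rfloor-1\bigr)$: $\ d_i\ge i-\lfloor 1/t\rfloor+2$ or $d_{n-i+\lfloor 1/t\rfloor-1}\ge n-i$; and (ii) for every integer $i$ with $1\le i\le\frac12 n$: $\ d_i\ge i$ or $d_n\ge n-i$. Then $\pi$ is forcibly $t$-tough.
   Context: All graphs are finite and simple (no loops or multiple edges). A degree sequence of a graph is any sequence consisting of its vertex degrees; here sequences are written in nondecreasing order. A sequence $\pi$ of integers is graphical if it is a degree sequence of some graph $G$, and any such $G$ is called a realization of $\pi$. For a graph $G$, $\omega(G)$ denotes its number of connected components. For $t\ge 0$, $G$ is $t$-tough if $t\cdot\omega(G-X)\le|X|$ for every $X\subseteq V(G)$ with $\omega(G-X)>1$. A graphical sequence $\pi$ is forcibly $t$-tough if every realization of $\pi$ is $t$-tough. *)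

theory Defs
  imports Complex_Main "HOL-Library.Multiset" "Graph_Theory.Graph_Theory"
begin

text \<open>
  Finite simple graphs are the structures satisfying \<open>pair_graph\<close>: a finite vertex set together
  with a symmetric, irreflexive set of ordered pairs of vertices, the edge \<open>uv\<close> being represented
  by both \<open>(u, v)\<close> and \<open>(v, u)\<close>. Hence the degree of a vertex is its out-degree, and the connected
  components are the strongly connected components (the maximal connected subgraphs; a connected
  graph is nonempty).
\<close>

definition num_components :: "('a, 'b) pre_digraph \<Rightarrow> nat" where
  "num_components G = card (pre_digraph.sccs G)"

definition tough :: "real \<Rightarrow> 'a pair_pre_digraph \<Rightarrow> bool" where
  "tough t G \<longleftrightarrow>
    (\<forall>X \<subseteq> pverts G. num_components (with_proj G \<restriction> (pverts G - X)) > 1 \<longrightarrow>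
       t * real (num_components (with_proj G \<restriction> (pverts G - X))) \<le> real (card X))"

definition realization :: "'a pair_pre_digraph \<Rightarrow> int list \<Rightarrow> bool" where
  "realization G \<pi> \<longleftrightarrow> pair_graph G \<and>
     mset \<pi> = image_mset (\<lambda>v. int (out_degree (with_proj G) v)) (mset_set (pverts G))"

text \<open>
  Every finite graph is isomorphic to one whose vertices are natural numbers, so the choice of the
  vertex type in the existential quantifier below is no restriction.
\<close>

definition graphical :: "int list \<Rightarrow> bool" where
  "graphical \<pi> \<longleftrightarrow> (\<exists>G :: nat pair_pre_digraph. realization G \<pi>)"

text \<open>
  HOL cannot quantify over types inside a formula, so the vertex type of the realizations is a
  parameter; results are meant to be stated for an arbitrary type \<open>'a\<close>.
\<close>

definition forcibly_tough :: "'a itself \<Rightarrow> real \<Rightarrow> int list \<Rightarrow> bool" where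
  "forcibly_tough _ t \<pi> \<longleftrightarrow> graphical \<pi> \<and>
     (\<forall>G :: 'a pair_pre_digraph. realization G \<pi> \<longrightarrow> tough t G)"

text \<open>The entry \<open>d\<^sub>i\<close> of \<open>\<pi> = (d\<^sub>1, \<dots>, d\<^sub>n)\<close>; only meaningful for \<open>1 \<le> i \<le> n\<close>.\<close>

definition entry :: "int list \<Rightarrow> int \<Rightarrow> int" where
  "entry \<pi> i = \<pi> ! nat (i - 1)"

end

theory Submission
  imports Defs "HOL-Library.Disjoint_Sets"
begin

text \<open>
  Write \<open>k\<close> for \<open>\<lfloor>1 / t\<rfloor>\<close> and suppose that a realization is not \<open>t\<close>-tough, because deleting \<open>x\<close>
  vertices leaves \<open>c \<ge> 2\<close> components with \<open>t c > x\<close>. A vertex of a component \<open>C\<close> is adjacent only to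
  deleted vertices and to vertices of \<open>C\<close>, so its degree is at most \<open>x + \<bar>C\<bar> - 1\<close>. A component is
  thus a set of vertices of small degree, and too many such vertices contradict the hypotheses.

  The parameter that makes this quantitative is the size \<open>m\<close> of the second largest component.
  All components but a largest one, of size \<open>l\<close>, have size at most \<open>m\<close>; they contain at least
  \<open>m + c - 2\<close> vertices, since one has size \<open>m\<close> and the others are nonempty. Hence \<open>m + c - 2\<close>
  vertices have degree at most \<open>x + m - 1\<close>, and all \<open>n - x\<close> undeleted vertices have degree at
  most \<open>x + l - 1\<close>, where \<open>l \<le> n - x - (m + c - 2)\<close>.

  If \<open>x \<ge> 1\<close>, then \<open>c > k x\<close> and therefore \<open>c \<ge> k x + 1 \<ge> x + k\<close>
  (\<open>card_plus_floor_le_components\<close>). Put \<open>i = x + m + k - 2\<close>. Then at least \<open>i\<close> vertices have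
  degree at most \<open>x + m - 1 = i - k + 1\<close>, and at least \<open>n - x \<ge> n - i + k - 1\<close> have degree at most
  \<open>n - i - 1\<close>. As also \<open>k \<le> i < (n + k - 1) / 2\<close>, both alternatives of the first hypothesis fail
  for \<open>i\<close>. If \<open>x = 0\<close>, the graph is disconnected, and \<open>i = m\<close> violates the second hypothesis in
  the same way.
\<close>

section \<open>Degree sequences\<close>

text \<open>
  This is the only bridge between the sequence and the graph: a set of at least \<open>j\<close> vertices of
  degree at most \<open>b\<close> forces the \<open>j\<close>-th entry down to \<open>b\<close>, because an entry larger than \<open>b\<close> at that
  place would leave at most \<open>j - 1\<close> entries of value at most \<open>b\<close>.
\<close>

lemma entry_le:
  fixes f :: "'v \<Rightarrow> int"
  assumes "sorted \<pi>" and \<pi>: "mset \<pi> = image_mset f (mset_set V)" and "finite V"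
    and "S \<subseteq> V" and le: "\<And>v. v \<in> S \<Longrightarrow> f v \<le> b" and "1 \<le> j" and "j \<le> int (card S)"
  shows "entry \<pi> j \<le> b"
proof (rule ccontr)
  define p where "p = nat (j - 1)"
  assume "\<not> entry \<pi> j \<le> b"
  then have big: "b < \<pi> ! p" by (simp add: entry_def p_def)
  have few: "{i. i < length \<pi> \<and> \<pi> ! i \<le> b} \<subseteq> {..<p}"
  proof clarify
    fix i assume i: "i < length \<pi>" "\<pi> ! i \<le> b"
    show "i < p"
    proof (rule ccontr)
      assume "\<not> i < p"
      then have "\<pi> ! p \<le> \<pi> ! i" using i \<open>sorted \<pi>\<close> by (simp add: sorted_nth_mono)
      then show False using i big by simp
    qed
  qed
  have "card S \<le> card {v \<in> V. f v \<le> b}"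
    using assms(3,4) le by (intro card_mono) auto
  also have "\<dots> = size (filter_mset (\<lambda>d. d \<le> b) (mset \<pi>))"
    using \<open>finite V\<close> by (simp add: \<pi> filter_mset_image_mset)
  also have "\<dots> = card {i. i < length \<pi> \<and> \<pi> ! i \<le> b}"
    by (simp flip: mset_filter add: length_filter_conv_card)
  also have "\<dots> \<le> p"
    using card_mono[OF _ few] by simp
  finally show False using assms(6,7) by (simp add: p_def)
qed

section \<open>The two largest classes of a partition\<close>

text \<open>
  The final inequality comes from counting the classes other than \<open>L\<close>: \<open>M\<close> contributes its size
  and each of the remaining \<open>card P - 2\<close> classes contributes at least one element.
\<close>

lemma two_largest_classes:
  assumes W: "finite W" and P: "partition_on W P" and two: "2 \<le> card P"
  obtains L M where "L \<in> P" "M \<in> P" "1 \<le> card M"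
    "\<forall>C\<in>P. card C \<le> card L" "\<forall>C\<in>P - {L}. card C \<le> card M"
    "card M + card P - 2 + card L \<le> card W"
proof -
  have finP: "finite P" using P W by (rule finite_elements[rotated])
  have fin: "finite C" if "C \<in> P" for C
  proof (rule finite_subset[OF _ W])
    show "C \<subseteq> W" using that partition_onD1[OF P] by blast
  qed
  have pos: "1 \<le> card C" if "C \<in> P" for C
    using that fin[OF that] partition_onD3[OF P] by (metis One_nat_def Suc_leI card_gt_0_iff)
  have largest: "\<exists>A\<in>Q. \<forall>C\<in>Q. card C \<le> card A" if "finite Q" "Q \<noteq> {}" for Q :: "'a set set"
    using that obtains_MAX[of Q card] by (metis Max_ge finite_imageI imageI)
  have "P \<noteq> {}" using two by auto
  then obtain L where L: "L \<in> P" "\<forall>C\<in>P. card C \<le> card L" using largest finP by blast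
  have rest: "card (P - {L}) = card P - 1" using L finP by simp
  then have "P - {L} \<noteq> {}" using two
    by (metis card.empty diff_is_0_eq not_less_eq_eq numeral_2_eq_2 One_nat_def)
  then obtain M where M: "M \<in> P - {L}" "\<forall>C\<in>P - {L}. card C \<le> card M"
    using largest[of "P - {L}"] finP by blast
  have rest': "card (P - {L} - {M}) = card P - 2" using M rest finP by simp
  have "card W = (\<Sum>C\<in>P. card C)"
    using P fin by (metis card_Union_disjoint partition_on_def disjoint_def pairwise_def disjnt_def)
  also have "\<dots> = card L + card M + (\<Sum>C\<in>P - {L} - {M}. card C)"
    using L M finP by (simp add: sum.remove)
  finally have "card W = card L + card M + (\<Sum>C\<in>P - {L} - {M}. card C)" .
  moreover have "(\<Sum>C\<in>P - {L} - {M}. 1) \<le> (\<Sum>C\<in>P - {L} - {M}. card C)"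
    using pos by (intro sum_mono) auto
  ultimately have "card M + card P - 2 + card L \<le> card W" using rest' two by simp
  with that[of L M] L M pos show thesis by auto
qed

section \<open>Components after deleting vertices\<close>

context pair_graph
begin

lemma partition_on_components:
  "partition_on W (pre_digraph.sccs_verts (with_proj G \<restriction> W))"
proof -
  interpret H: wf_digraph "with_proj G \<restriction> W" by (rule wellformed_induce_subgraph)
  show ?thesis
  proof (rule partition_onI)
    show "\<Union> H.sccs_verts = W"
      using H.in_scc_of_self H.sccs_verts_subsets by (fastforce simp: H.sccs_verts_conv_scc_of)
    show "{} \<notin> H.sccs_verts" by (simp add: H.sccs_verts_def)
    show "disjnt p q" if "p \<in> H.sccs_verts" "q \<in> H.sccs_verts" "p \<noteq> q" for p q
      using H.sccs_verts_disjoint[OF that] by (simp add: disjnt_def)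
  qed
qed

text \<open>
  A neighbour of \<open>v\<close> that survives the deletion of \<open>X\<close> lies in the component of \<open>v\<close>. So all
  neighbours lie in \<open>X \<union> (C - {v})\<close>; that \<open>v\<close> is not its own neighbour makes the bound strict.
\<close>

lemma out_degree_less_component:
  assumes "X \<subseteq> pverts G" and C: "C \<in> pre_digraph.sccs_verts (with_proj G \<restriction> (pverts G - X))"
    and v: "v \<in> C"
  shows "out_degree (with_proj G) v < card X + card C"
proof -
  let ?H = "with_proj G \<restriction> (pverts G - X)"
  interpret H: wf_digraph ?H by (rule wellformed_induce_subgraph)
  have CW: "C \<subseteq> pverts G - X" using H.sccs_verts_subsets[OF C] by simp
  have fin: "finite X" "finite C"
    using CW assms(1) pair_finite_verts finite_subset by blast+
  have "w \<in> X \<union> (C - {v})" if e: "(v, w) \<in> parcs G" for w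
  proof (cases "w \<in> X")
    case False
    have vw: "v \<in> pverts G - X" "w \<in> pverts G - X"
      using False CW v in_arcsD2[OF e] by auto
    have "(w, v) \<in> parcs G" using e pair_sym_arcs by (auto simp: symmetric_def sym_def)
    then have "v \<rightarrow>\<^bsub>?H\<^esub> w" "w \<rightarrow>\<^bsub>?H\<^esub> v" using vw e
      by (force simp: arcs_ends_conv)+
    then have "w \<in> C"
      using C v unfolding H.in_sccs_verts_conv_reachable by (meson H.reachable_adjI)
    moreover have "w \<noteq> v" using pair_no_loops[OF e] by auto
    ultimately show ?thesis by simp
  qed simp
  then have "{w. (v, w) \<in> parcs G} \<subseteq> X \<union> (C - {v})" by blast
  moreover have "snd ` out_arcs (with_proj G) v \<subseteq> {w. (v, w) \<in> parcs G}"
    by (auto simp: out_arcs_def)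
  ultimately have "snd ` out_arcs (with_proj G) v \<subseteq> X \<union> (C - {v})" by (rule order_trans[rotated])
  moreover have "inj_on snd (out_arcs (with_proj G) v)"
    by (auto simp: inj_on_def out_arcs_def)
  ultimately have "out_degree (with_proj G) v \<le> card (X \<union> (C - {v}))"
    unfolding out_degree_def using fin by (metis card_inj_on_le finite_Diff finite_UnI)
  moreover have "\<dots> \<le> card X + card (C - {v})" by (rule card_Un_le)
  moreover have "card (C - {v}) < card C"
    using v fin by (intro card_Diff1_less)
  ultimately show ?thesis by linarith
qed

text \<open>
  Components are induced subgraphs, hence determined by their vertex sets; counting the latter
  brings the number of components into reach of arguments about partitions.
\<close>

lemma num_components_eq_card_sccs_verts:
  "num_components (with_proj G \<restriction> W) = card (pre_digraph.sccs_verts (with_proj G \<restriction> W))"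
proof -
  interpret H: wf_digraph "with_proj G \<restriction> W" by (rule wellformed_induce_subgraph)
  show ?thesis by (simp add: num_components_def H.card_sccs_verts)
qed

end

section \<open>The degree condition\<close>

text \<open>
  With \<open>k = \<lfloor>1 / t\<rfloor> \<ge> 1\<close>, the violated toughness inequality gives \<open>k x < c\<close>, and
  \<open>k x + 1 - (x + k) = (k - 1) (x - 1) \<ge> 0\<close>. For \<open>x = 0\<close> the violated inequality
  says only \<open>c > 0\<close>, and nothing relates \<open>c\<close> to \<open>k\<close>; disconnected graphs therefore need a
  hypothesis of their own.
\<close>

lemma card_plus_floor_le_components:
  fixes t :: real and x c :: nat
  assumes "0 < t" "t \<le> 1" and "real x < t * real c" and "1 \<le> x"
  shows "int x + \<lfloor>1 / t\<rfloor> \<le> int c"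
proof -
  let ?k = "\<lfloor>1 / t\<rfloor>"
  have k: "1 \<le> ?k" using assms by simp
  have "real_of_int (?k * int x) \<le> 1 / t * real x"
    unfolding of_int_mult of_int_of_nat_eq by (intro mult_right_mono) simp_all
  also have "\<dots> < real c" using assms by (simp add: field_simps)
  finally have "?k * int x < int c" by linarith
  moreover have "0 \<le> (?k - 1) * (int x - 1)" using k \<open>1 \<le> x\<close> by simp
  ultimately show ?thesis by (simp add: algebra_simps)
qed

theorem theorem5p2:
  fixes t :: real and n :: int and \<pi> :: "int list"
  assumes "0 < t" and "t \<le> 1"
    and "n \<ge> \<lfloor>1 / t\<rfloor> + 2"
    and "int (length \<pi>) = n" and "sorted \<pi>" and "graphical \<pi>"
    and "\<forall>i :: int. \<lfloor>1 / t\<rfloor> \<le> i \<and>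
           real_of_int i < 1 / 2 * (real_of_int n + real_of_int \<lfloor>1 / t\<rfloor> - 1) \<longrightarrow>
           entry \<pi> i \<ge> i - \<lfloor>1 / t\<rfloor> + 2 \<or> entry \<pi> (n - i + \<lfloor>1 / t\<rfloor> - 1) \<ge> n - i"
    and "\<forall>i :: int. 1 \<le> i \<and> real_of_int i \<le> 1 / 2 * real_of_int n \<longrightarrow>
           entry \<pi> i \<ge> i \<or> entry \<pi> n \<ge> n - i"
  shows "forcibly_tough TYPE('a) t \<pi>"
proof -
  let ?k = "\<lfloor>1 / t\<rfloor>"
  have k: "1 \<le> ?k" using assms(1,2) by simp
  have n1: "1 \<le> n" using k assms(3) by linarith
  have "tough t G" if "realization G \<pi>" for G :: "'a pair_pre_digraph"
  proof (rule ccontr)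
    assume "\<not> tough t G"
    then obtain X where X: "X \<subseteq> pverts G"
      and c: "num_components (with_proj G \<restriction> (pverts G - X)) > 1"
      and x: "real (card X) < t * real (num_components (with_proj G \<restriction> (pverts G - X)))"
      unfolding tough_def not_all not_imp not_le by blast
    interpret pair_graph G using that by (simp add: realization_def)
    let ?W = "pverts G - X" and ?deg = "\<lambda>v. int (out_degree (with_proj G) v)"
    define P where "P = pre_digraph.sccs_verts (with_proj G \<restriction> ?W)"
    have \<pi>: "mset \<pi> = image_mset ?deg (mset_set (pverts G))"
      using that by (simp add: realization_def)
    have "int (size (mset \<pi>)) = n" using assms(4) by simp
    then have n: "n = int (card (pverts G))" by (simp add: \<pi>)
    have finX: "finite X" and leX: "card X \<le> card (pverts G)"
      using X pair_finite_verts by (auto intro: finite_subset card_mono)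
    have W: "int (card ?W) = n - int (card X)"
      using X finX leX by (simp add: n card_Diff_subset)
    have P: "partition_on ?W P" unfolding P_def by (rule partition_on_components)
    have cP: "1 < card P" and xP: "real (card X) < t * real (card P)"
      using c x by (simp_all add: P_def num_components_eq_card_sccs_verts)
    have finW: "finite ?W" and two: "2 \<le> card P"
      using pair_finite_verts cP by auto
    obtain L M where LM: "L \<in> P" "M \<in> P" "1 \<le> card M"
      and largest: "\<forall>C\<in>P. card C \<le> card L"
      and others: "\<forall>C\<in>P - {L}. card C \<le> card M"
      and size: "card M + card P - 2 + card L \<le> card ?W"
      by (rule two_largest_classes[OF finW P two])
    have leL: "card M \<le> card L" using largest LM(2) ..
    have deg: "?deg v \<le> int (card X) + int (card C) - 1" if "v \<in> C" "C \<in> P" for v C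
      using out_degree_less_component[OF X, of C v] that by (simp add: P_def)
    have degL: "?deg v \<le> int (card X) + int (card L) - 1" if "v \<in> ?W" for v
    proof -
      have "v \<in> \<Union>P" using that unfolding partition_onD1[OF P, symmetric] by simp
      then obtain C where "v \<in> C" "C \<in> P" by (rule UnionE)
      moreover have "card C \<le> card L" using largest \<open>C \<in> P\<close> ..
      ultimately show ?thesis using deg[of v C] by simp
    qed
    have degM: "?deg v \<le> int (card X) + int (card M) - 1" if "v \<in> ?W - L" for v
    proof -
      have "v \<in> \<Union>P" using that unfolding partition_onD1[OF P, symmetric] by simp
      then obtain C where "v \<in> C" "C \<in> P" by (rule UnionE)
      moreover have "card C \<le> card M" using others \<open>C \<in> P\<close> \<open>v \<in> C\<close> that by auto
      ultimately show ?thesis using deg[of v C] by simp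
    qed
    have "L \<subseteq> ?W" using LM(1) unfolding partition_onD1[OF P] by (rule Union_upper)
    then have WL: "card (?W - L) = card ?W - card L"
      using pair_finite_verts by (meson card_Diff_subset finite_Diff finite_subset)
    note entry = entry_le[OF \<open>sorted \<pi>\<close> \<pi> pair_finite_verts]
    show False
    proof (cases "card X = 0")
      case True
      \<comment> \<open>With nothing deleted, the degree bound \<open>x + m - 1\<close> outside \<open>L\<close> is \<open>m - 1\<close>.\<close>
      let ?i = "int (card M)"
      have "entry \<pi> ?i \<le> ?i - 1"
        using degM size WL LM cP True by (intro entry[of "?W - L"]) auto
      moreover have "entry \<pi> n \<le> int (card L) - 1"
        using degL True n n1 by (intro entry[of ?W]) (auto simp: W)
      moreover have "int (card L) + ?i \<le> n" using size W cP True by linarith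
      moreover have "real_of_int ?i \<le> 1 / 2 * real_of_int n" "1 \<le> ?i"
        using calculation(3) LM(3) leL by linarith+
      ultimately show False using assms(8)[rule_format, of ?i] by linarith
    next
      case False
      \<comment> \<open>The index is chosen so that \<open>i - k + 1\<close> is the degree bound for the components
        other than \<open>L\<close>, which contain at least \<open>i\<close> vertices.\<close>
      define i where "i = int (card X) + int (card M) + ?k - 2"
      have c: "int (card X) + ?k \<le> int (card P)"
        using assms(1,2) xP False by (intro card_plus_floor_le_components) auto
      have "?k \<le> i" using False LM(3) unfolding i_def by linarith
      moreover have "1 \<le> i" "i \<le> int (card (?W - L))"
        using calculation k size WL c cP unfolding i_def by linarith+
      then have "entry \<pi> i \<le> int (card X) + int (card M) - 1"
        using degM unfolding i_def by (intro entry[of "?W - L"]) blast+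
      moreover have "1 \<le> n - i + ?k - 1" "n - i + ?k - 1 \<le> int (card ?W)"
        using W size LM(3) cP unfolding i_def by linarith+
      then have "entry \<pi> (n - i + ?k - 1) \<le> int (card X) + int (card L) - 1"
        using degL by (intro entry[of ?W]) blast+
      moreover have L: "int (card L) \<le> n - 2 * int (card X) - int (card M) - ?k + 2"
        using size W c cP by linarith
      moreover have "2 * i < n + ?k - 1"
        using L leL by (simp add: i_def algebra_simps)
      then have "real_of_int (2 * i) < real_of_int (n + ?k - 1)" by (simp only: of_int_less_iff)
      then have "real_of_int i < 1 / 2 * (real_of_int n + real_of_int ?k - 1)" by simp
      ultimately show False using assms(7)[rule_format, of i] unfolding i_def by linarith
    qed
  qed
  with \<open>graphical \<pi>\<close> show ?thesis by (simp add: forcibly_tough_def)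
qed

end
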